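(* Let $d\ge1$. The transformation $\mathcal{A}_2$ is an Upsilon transformation; namely $\mathcal{A}_2=\Upsilon_\tau$ (same domain, same values) with dilation measure $\tau(\mathrm{d}u)=2\pi^{-1}(1-u^2)^{-1/2}1_{(0,1)}(u)\,\mathrm{d}u$, so that $$\mathcal{A}_{2}(\nu)(B)=\int_{0}^{1} \nu(u^{-1}B)\, 2\pi^{-1}(1-u^{2})^{-1/2}\,\mathrm{d}u,\qquad B\in\mathcal{B}(\mathbb{R}^{d}),$$ for $\nu\in\mathfrak{M}_{L}(\mathbb{R}^{d})$.
   Context: $\mathfrak{M}_L(\mathbb{R}^d)$ is the class of Lévy measures on $\mathbb{R}^d$: measures $\nu$ with $\nu(\{0\})=0$ and $\int_{\mathbb{R}^d}(1\wedge|x|^2)\,\nu(\mathrm{d}x)<\infty$. For $s>0$ let $a_2(r;s)=2\pi^{-1}(s^2-r^2)^{-1/2}1_{(0,s)}(r)$. For a measure $\nu$ on $\mathbb{R}^d$ define $$\mathcal{A}_2(\nu)(B)=\int_{\mathbb{R}^d\setminus\{0\}}\nu(\mathrm{d}x)\int_0^\infty a_2(r;|x|)\,1_B\!\left(r\frac{x}{|x|}\right)\mathrm{d}r,\qquad B\in\mathcal{B}(\mathbb{R}^d).$$ The domain $\mathfrak{D}(\mathcal{A}_2)$ is the class of measures $\nu$ on $\mathbb{R}^d$ such that $\nu(\{0\})=0$ and the right-hand side is a measure belonging to $\mathfrak{M}_L(\mathbb{R}^d)$. (It is a fact that $\mathfrak{D}(\mathcal{A}_2)=\mathfrak{M}_L(\mathbb{R}^d)$.)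 Given a measure $\tau$ on $(0,\infty)$, the Upsilon transformation $\Upsilon_\tau$ with dilation measure $\tau$ is $$\Upsilon_\tau(\nu)(B)=\int_0^\infty\nu(u^{-1}B)\,\tau(\mathrm{d}u),\qquad B\in\mathcal{B}(\mathbb{R}^d),$$ with domain the class of $\sigma$-finite measures $\nu$ on $\mathbb{R}^d$ such that the right-hand side is a measure in $\mathfrak{M}_L(\mathbb{R}^d)$. *)

theory Defs
  imports "HOL-Analysis.Analysis"
begin

text \<open>A measure on the Euclidean space \<^typ>\<open>'a\<close> is a measure whose sigma-algebra is that of \<^term>\<open>borel\<close>.\<close>

definition levy_measures :: "'a::euclidean_space measure set" where
  "levy_measures =
    {\<nu>. sets \<nu> = sets borel \<and> emeasure \<nu> {0} = 0 \<and>
        (\<integral>\<^sup>+x. ennreal (min 1 ((norm x)\<^sup>2)) \<partial>\<nu>) < \<infinity>}"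

definition a2 :: "real \<Rightarrow> real \<Rightarrow> real" where
  "a2 r s = 2 / pi * (s\<^sup>2 - r\<^sup>2) powr (- 1 / 2) * indicator {0<..<s} r"

definition A2_fun :: "'a::euclidean_space measure \<Rightarrow> 'a set \<Rightarrow> ennreal" where
  "A2_fun \<nu> B =
    (\<integral>\<^sup>+x\<in>UNIV - {0}.
       (\<integral>\<^sup>+r\<in>{0<..}. ennreal (a2 r (norm x)) * indicator B (r *\<^sub>R (x /\<^sub>R norm x)) \<partial>lborel) \<partial>\<nu>)"

text \<open>\<^const>\<open>measure_of\<close> returns the null measure when the given set function is not a measure, so
  the domains below require \<^const>\<open>measure_space\<close> of the set function separately.\<close>

definition A2 :: "'a::euclidean_space measure \<Rightarrow> 'a measure" where
  "A2 \<nu> = measure_of UNIV (sets borel) (A2_fun \<nu>)"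

definition A2_domain :: "'a::euclidean_space measure set" where
  "A2_domain =
    {\<nu>. sets \<nu> = sets borel \<and> emeasure \<nu> {0} = 0 \<and>
        measure_space UNIV (sets borel) (A2_fun \<nu>) \<and> A2 \<nu> \<in> levy_measures}"

text \<open>The dilation measure \<open>\<tau>\<close> is a measure with underlying space \<^term>\<open>{0<..} :: real set\<close>, so the
  integral over \<open>\<tau>\<close> ranges over the positive half-line only.\<close>

definition Upsilon_fun :: "real measure \<Rightarrow> 'a::euclidean_space measure \<Rightarrow> 'a set \<Rightarrow> ennreal" where
  "Upsilon_fun \<tau> \<nu> B = (\<integral>\<^sup>+u. emeasure \<nu> ((*\<^sub>R) (inverse u) ` B) \<partial>\<tau>)"

definition Upsilon :: "real measure \<Rightarrow> 'a::euclidean_space measure \<Rightarrow> 'a measure" where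
  "Upsilon \<tau> \<nu> = measure_of UNIV (sets borel) (Upsilon_fun \<tau> \<nu>)"

definition Upsilon_domain :: "real measure \<Rightarrow> 'a::euclidean_space measure set" where
  "Upsilon_domain \<tau> =
    {\<nu>. sets \<nu> = sets borel \<and> sigma_finite_measure \<nu> \<and>
        measure_space UNIV (sets borel) (Upsilon_fun \<tau> \<nu>) \<and> Upsilon \<tau> \<nu> \<in> levy_measures}"

definition A2_dilation :: "real measure" where
  "A2_dilation =
    density (restrict_space lborel {0<..})
      (\<lambda>u. ennreal (2 / pi * (1 - u\<^sup>2) powr (- 1 / 2) * indicator {0<..<1} u))"

end

theory Submission imports Defs begin

text \<open>
  Substituting \<open>r = u * norm x\<close> in the inner integral that defines \<^const>\<open>A2_fun\<close> turns the
  kernel \<^term>\<open>a2 r (norm x)\<close> into the arcsine density on the unit interval, which no longer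
  depends on \<open>x\<close>, and turns the point \<open>r x / norm x\<close> into \<open>u x\<close>. Hence
  \<^term>\<open>A2_fun \<nu> B\<close> is the iterated integral of \<open>w u * indicator B (u x)\<close> with \<open>w\<close> that density,
  first over \<open>u\<close> and then over \<open>x \<noteq> 0\<close>, and for \<open>u > 0\<close> the condition \<open>u x \<in> B\<close> says that \<open>x\<close> lies in \<open>B\<close> dilated by
  \<^term>\<open>inverse u\<close>. If \<open>\<nu>\<close> is sigma-finite without mass at the origin, exchanging the two integrals
  (Tonelli) yields the Upsilon transform; this is lemma \<open>A2_fun_eq_Upsilon_fun\<close>.

  The equality of the domains then reduces to showing that the elements of either domain are
  sigma-finite and do not charge the origin. The definition of \<^const>\<open>A2_domain\<close> lacks the first
  property. It holds because a point \<open>x\<close> with \<open>norm x \<ge> 2 e\<close> is sent outside the open ball of radius \<open>e\<close>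
  with probability bounded below, independently of \<open>x\<close>: as the Levy measure \<^term>\<open>A2 \<nu>\<close> is finite
  outside balls around the origin, so is \<open>\<nu>\<close>. The definition of \<^const>\<open>Upsilon_domain\<close> lacks the
  second property. It holds because dilations fix the origin, so a mass of \<open>\<nu>\<close> there would survive
  in \<^term>\<open>Upsilon A2_dilation \<nu>\<close>. A Levy measure has both properties, so the integral formula
  holds for it; here \<^const>\<open>A2_fun\<close> has to be shown countably additive, since otherwise
  \<^const>\<open>A2\<close> would be the null measure.
\<close>

definition arcsine_density :: "real \<Rightarrow> ennreal" where
  "arcsine_density u = ennreal (2 / pi * (1 - u\<^sup>2) powr (- 1 / 2) * indicator {0<..<1} u)"

lemma arcsine_density_measurable [measurable]: "arcsine_density \<in> borel_measurable borel"
  unfolding arcsine_density_def by measurable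

lemma arcsine_density_ge:
  assumes "0 < u" "u < 1"
  shows "ennreal (2 / pi) \<le> arcsine_density u"
proof -
  have "u\<^sup>2 < 1" using assms by (simp add: power_less_one_iff)
  then have "1 \<le> (1 - u\<^sup>2) powr (- 1 / 2)"
    using powr_mono2'[of "- 1 / 2" "1 - u\<^sup>2" 1] assms by simp
  then have "2 / pi * 1 \<le> 2 / pi * (1 - u\<^sup>2) powr (- 1 / 2)"
    by (intro mult_left_mono) auto
  then show ?thesis
    unfolding arcsine_density_def using assms by (intro ennreal_leI) simp
qed

section \<open>Both transforms as iterated integrals against the arcsine density\<close>

text \<open>The kernel is homogeneous of degree \<open>-1\<close>, which compensates the factor \<open>s\<close> from the
  substitution \<open>r = s u\<close>.\<close>

lemma a2_scale:
  assumes "s > 0"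
  shows "s * a2 (s * u) s * indicator {0<..} (s * u) =
    2 / pi * (1 - u\<^sup>2) powr (- 1 / 2) * indicator {0<..<1} u"
proof (cases "0 < u \<and> u < 1")
  case True
  have u: "u\<^sup>2 < 1" using True by (simp add: power_less_one_iff)
  have "(s\<^sup>2 - (s * u)\<^sup>2) powr (- 1 / 2) = (s\<^sup>2) powr (- 1 / 2) * (1 - u\<^sup>2) powr (- 1 / 2)"
    using u by (subst powr_mult[symmetric]) (auto simp: algebra_simps)
  moreover have "(s\<^sup>2) powr (- 1 / 2) = inverse s"
  proof -
    have "s\<^sup>2 = s powr 2" using assms by simp
    then show ?thesis using assms by (simp only: powr_powr) (simp add: powr_minus)
  qed
  ultimately show ?thesis using True assms by (simp add: a2_def)
next
  case False
  then show ?thesis using assms by (auto simp: a2_def indicator_def zero_less_mult_iff)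
qed

lemma a2_measurable [measurable]: "(\<lambda>r. a2 r s) \<in> borel_measurable borel"
  unfolding a2_def by measurable

lemma nn_integral_a2:
  fixes x :: "'a::euclidean_space"
  assumes x: "x \<noteq> 0" and B [measurable]: "B \<in> sets borel"
  shows "(\<integral>\<^sup>+r\<in>{0<..}. ennreal (a2 r (norm x)) * indicator B (r *\<^sub>R (x /\<^sub>R norm x)) \<partial>lborel) =
    (\<integral>\<^sup>+u. arcsine_density u * indicator B (u *\<^sub>R x) \<partial>lborel)"
proof -
  let ?s = "norm x"
  let ?f = "\<lambda>r. ennreal (a2 r ?s) * indicator B (r *\<^sub>R (x /\<^sub>R ?s)) * indicator {0<..} r"
  have s: "?s > 0" using x by simp
  have "(\<integral>\<^sup>+r. ?f r \<partial>lborel) = ennreal \<bar>?s\<bar> * (\<integral>\<^sup>+u. ?f (0 + ?s * u) \<partial>lborel)"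
    by (rule nn_integral_real_affine) (use x in auto)
  also have "\<dots> = (\<integral>\<^sup>+u. ennreal \<bar>?s\<bar> * ?f (0 + ?s * u) \<partial>lborel)"
    by (rule nn_integral_cmult[symmetric]) measurable
  also have "\<dots> = (\<integral>\<^sup>+u. arcsine_density u * indicator B (u *\<^sub>R x) \<partial>lborel)"
  proof (intro nn_integral_cong)
    fix u :: real
    have kernel: "ennreal \<bar>?s\<bar> * (ennreal (a2 (?s * u) ?s) * indicator {0<..} (?s * u)) =
        arcsine_density u"
      unfolding arcsine_density_def a2_scale[OF s, symmetric]
      using s by (simp add: indicator_def ennreal_mult')
    have point: "(?s * u) *\<^sub>R (x /\<^sub>R ?s) = u *\<^sub>R x" using s by simp
    have "ennreal \<bar>?s\<bar> * ?f (0 + ?s * u) =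
        (ennreal \<bar>?s\<bar> * (ennreal (a2 (?s * u) ?s) * indicator {0<..} (?s * u))) *
          indicator B ((?s * u) *\<^sub>R (x /\<^sub>R ?s))"
      by (simp only: add_0 ac_simps)
    then show "ennreal \<bar>?s\<bar> * ?f (0 + ?s * u) = arcsine_density u * indicator B (u *\<^sub>R x)"
      by (simp only: kernel point)
  qed
  finally show ?thesis .
qed

lemma A2_fun_eq_nn_integral:
  fixes \<nu> :: "'a::euclidean_space measure"
  assumes "B \<in> sets borel"
  shows "A2_fun \<nu> B =
    (\<integral>\<^sup>+x\<in>UNIV - {0}. (\<integral>\<^sup>+u. arcsine_density u * indicator B (u *\<^sub>R x) \<partial>lborel) \<partial>\<nu>)"
  unfolding A2_fun_def
proof (intro nn_integral_cong)
  fix x :: 'a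
  show "(\<integral>\<^sup>+r\<in>{0<..}. ennreal (a2 r (norm x)) * indicator B (r *\<^sub>R (x /\<^sub>R norm x)) \<partial>lborel)
      * indicator (UNIV - {0}) x =
    (\<integral>\<^sup>+u. arcsine_density u * indicator B (u *\<^sub>R x) \<partial>lborel) * indicator (UNIV - {0}) x"
  proof (cases "x = 0")
    case False
    then show ?thesis by (simp only: nn_integral_a2[OF False assms])
  qed simp
qed

lemma dilation_vimage:
  fixes B :: "'a::real_vector set"
  assumes "u > 0"
  shows "(*\<^sub>R) (inverse u) ` B = (\<lambda>x. u *\<^sub>R x) -` B"
proof -
  have "x \<in> (*\<^sub>R) (inverse u) ` B" if "u *\<^sub>R x \<in> B" for x
    using that assms by (intro image_eqI[of _ _ "u *\<^sub>R x"]) auto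
  then show ?thesis using assms by auto
qed

lemma emeasure_dilation:
  fixes \<nu> :: "'a::euclidean_space measure"
  assumes \<nu>: "sets \<nu> = sets borel" and B [measurable]: "B \<in> sets borel" and u: "u > 0"
  shows "emeasure \<nu> ((*\<^sub>R) (inverse u) ` B) = (\<integral>\<^sup>+x. indicator B (u *\<^sub>R x) \<partial>\<nu>)"
proof -
  have "(\<lambda>x::'a. u *\<^sub>R x) -` B \<inter> space borel \<in> sets borel" by measurable
  then have "(\<lambda>x. u *\<^sub>R x) -` B \<in> sets \<nu>" by (simp add: \<nu>)
  then have "emeasure \<nu> ((\<lambda>x. u *\<^sub>R x) -` B) = (\<integral>\<^sup>+x. indicator ((\<lambda>x. u *\<^sub>R x) -` B) x \<partial>\<nu>)"
    by simp
  then show ?thesis using u by (simp add: dilation_vimage indicator_def)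
qed

lemma arcsine_kernel_measurable:
  fixes \<nu> :: "'a::euclidean_space measure"
  assumes \<nu> [measurable_cong]: "sets \<nu> = sets borel" and B [measurable]: "B \<in> sets borel"
  shows "(\<lambda>(x, u). arcsine_density u * indicator B (u *\<^sub>R x))
    \<in> borel_measurable (\<nu> \<Otimes>\<^sub>M lborel)"
  by measurable

text \<open>Sigma-finiteness makes \<open>u \<mapsto> \<nu> (u\<^sup>-\<^sup>1 B)\<close> measurable, so that the integral with respect
  to \<^const>\<open>A2_dilation\<close> can be written as a Lebesgue integral against its density.\<close>

lemma Upsilon_fun_A2_dilation:
  fixes \<nu> :: "'a::euclidean_space measure"
  assumes \<nu> [measurable_cong]: "sets \<nu> = sets borel" and fin: "sigma_finite_measure \<nu>"
    and B [measurable]: "B \<in> sets borel"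
  shows "Upsilon_fun A2_dilation \<nu> B =
    (\<integral>\<^sup>+u\<in>{0<..<1}. emeasure \<nu> ((*\<^sub>R) (inverse u) ` B)
      * ennreal (2 / pi * (1 - u\<^sup>2) powr (- 1 / 2)) \<partial>lborel)"
    (is "_ = ?dilated")
    and "Upsilon_fun A2_dilation \<nu> B =
    (\<integral>\<^sup>+u. \<integral>\<^sup>+x. arcsine_density u * indicator B (u *\<^sub>R x) \<partial>\<nu> \<partial>lborel)"
    (is "_ = ?iterated")
proof -
  interpret sigma_finite_measure \<nu> by fact
  let ?g = "\<lambda>u::real. \<integral>\<^sup>+x. indicator B (u *\<^sub>R x) \<partial>\<nu>"
  have g [measurable]: "?g \<in> borel_measurable borel" by measurable
  have dens: "(\<lambda>u. ennreal (2 / pi * (1 - u\<^sup>2) powr (- 1 / 2) * indicator {0<..<1} u))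
      \<in> borel_measurable (restrict_space lborel {0<..})"
    by (intro measurable_restrict_space1) measurable
  have "Upsilon_fun A2_dilation \<nu> B = (\<integral>\<^sup>+u. ?g u \<partial>A2_dilation)"
    unfolding Upsilon_fun_def
    by (intro nn_integral_cong)
      (auto simp: A2_dilation_def space_restrict_space emeasure_dilation[OF \<nu> B])
  also have "\<dots> = (\<integral>\<^sup>+u. arcsine_density u * ?g u \<partial>restrict_space lborel {0<..})"
    unfolding A2_dilation_def arcsine_density_def
    by (intro nn_integral_density dens measurable_restrict_space1) measurable
  also have "\<dots> = (\<integral>\<^sup>+u. arcsine_density u * ?g u * indicator {0<..} u \<partial>lborel)"
    by (subst nn_integral_restrict_space) auto
  also have "\<dots> = (\<integral>\<^sup>+u. arcsine_density u * ?g u \<partial>lborel)"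
    by (intro nn_integral_cong) (auto simp: arcsine_density_def indicator_def)
  finally have eq: "Upsilon_fun A2_dilation \<nu> B = (\<integral>\<^sup>+u. arcsine_density u * ?g u \<partial>lborel)" .
  show "Upsilon_fun A2_dilation \<nu> B = ?dilated"
    unfolding eq
    by (intro nn_integral_cong)
      (auto simp: arcsine_density_def indicator_def emeasure_dilation[OF \<nu> B] mult.commute)
  show "Upsilon_fun A2_dilation \<nu> B = ?iterated"
    unfolding eq by (intro nn_integral_cong nn_integral_cmult[symmetric]) measurable
qed

theorem A2_fun_eq_Upsilon_fun:
  fixes \<nu> :: "'a::euclidean_space measure"
  assumes \<nu> [measurable_cong]: "sets \<nu> = sets borel" and fin: "sigma_finite_measure \<nu>"
    and zero: "emeasure \<nu> {0} = 0" and B [measurable]: "B \<in> sets borel"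
  shows "A2_fun \<nu> B = Upsilon_fun A2_dilation \<nu> B"
proof -
  interpret \<nu>: sigma_finite_measure \<nu> by fact
  interpret pair_sigma_finite \<nu> lborel ..
  have AE: "AE x in \<nu>. x \<noteq> 0"
    by (rule AE_I[of _ _ "{0}"]) (use zero in \<open>auto simp: \<nu>\<close>)
  have "A2_fun \<nu> B =
      (\<integral>\<^sup>+x. (\<integral>\<^sup>+u. arcsine_density u * indicator B (u *\<^sub>R x) \<partial>lborel) \<partial>\<nu>)"
    unfolding A2_fun_eq_nn_integral[OF B]
    by (rule nn_integral_cong_AE) (use AE in eventually_elim, auto)
  also have "\<dots> = (\<integral>\<^sup>+u. (\<integral>\<^sup>+x. arcsine_density u * indicator B (u *\<^sub>R x) \<partial>\<nu>) \<partial>lborel)"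
    by (rule Fubini'[symmetric, OF arcsine_kernel_measurable[OF \<nu> B]])
  finally show ?thesis by (simp add: Upsilon_fun_A2_dilation(2)[OF \<nu> fin B])
qed

section \<open>The transforms as measures\<close>

lemma measure_space_A2_fun:
  fixes \<nu> :: "'a::euclidean_space measure"
  assumes \<nu> [measurable_cong]: "sets \<nu> = sets borel"
  shows "measure_space UNIV (sets borel) (A2_fun \<nu>)"
proof -
  have "countably_additive (sets borel) (A2_fun \<nu>)"
  proof (rule countably_additiveI)
    fix A :: "nat \<Rightarrow> 'a set"
    assume A: "range A \<subseteq> sets borel" and disj: "disjoint_family A"
      and UN: "(\<Union>i. A i) \<in> sets borel"
    have [measurable]: "A i \<in> sets borel" for i using A by auto
    have "(\<Sum>i. A2_fun \<nu> (A i)) = (\<integral>\<^sup>+x. (\<Sum>i. (\<integral>\<^sup>+u. arcsine_density u *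
        indicator (A i) (u *\<^sub>R x) \<partial>lborel) * indicator (UNIV - {0}) x) \<partial>\<nu>)"
      by (subst nn_integral_suminf) (measurable, simp add: A2_fun_eq_nn_integral)
    also have "\<dots> = (\<integral>\<^sup>+x\<in>UNIV - {0}. (\<integral>\<^sup>+u. arcsine_density u *
        indicator (\<Union>i. A i) (u *\<^sub>R x) \<partial>lborel) \<partial>\<nu>)"
      by (intro nn_integral_cong)
        (simp add: ennreal_suminf_multc suminf_indicator[OF disj, symmetric]
          nn_integral_suminf[symmetric] flip: ennreal_suminf_cmult)
    also have "\<dots> = A2_fun \<nu> (\<Union>i. A i)" by (rule A2_fun_eq_nn_integral[OF UN, symmetric])
    finally show "(\<Sum>i. A2_fun \<nu> (A i)) = A2_fun \<nu> (\<Union>i. A i)" .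
  qed
  moreover have "positive (sets borel) (A2_fun \<nu>)"
    by (simp add: positive_def A2_fun_def)
  moreover have "sigma_algebra (UNIV :: 'a set) (sets borel)"
    using sets.sigma_algebra_axioms[of "borel :: 'a measure"] by simp
  ultimately show ?thesis by (simp add: measure_space_def)
qed

lemma sigma_sets_borel: "sigma_sets UNIV (sets borel) = sets borel"
  using sets.sigma_sets_eq[of borel] by simp

lemma emeasure_measure_of_borel:
  assumes "measure_space UNIV (sets borel) \<mu>" "B \<in> sets borel"
  shows "emeasure (measure_of UNIV (sets borel) \<mu>) B = \<mu> B"
  using assms by (simp add: emeasure_measure_of_conv sigma_sets_borel)

lemma
  fixes \<nu> :: "'a::euclidean_space measure"
  assumes "sets \<nu> = sets borel" "sigma_finite_measure \<nu>" "emeasure \<nu> {0} = 0"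
  shows measure_space_A2_iff_Upsilon: "measure_space UNIV (sets borel) (A2_fun \<nu>) =
      measure_space UNIV (sets borel) (Upsilon_fun A2_dilation \<nu>)"
    and A2_eq_Upsilon: "A2 \<nu> = Upsilon A2_dilation \<nu>"
proof -
  have eq: "A2_fun \<nu> B = Upsilon_fun A2_dilation \<nu> B" if "B \<in> sigma_sets UNIV (sets borel)" for B
    using A2_fun_eq_Upsilon_fun[OF assms] that by (simp add: sigma_sets_borel)
  show "measure_space UNIV (sets borel) (A2_fun \<nu>) =
      measure_space UNIV (sets borel) (Upsilon_fun A2_dilation \<nu>)"
    using measure_space_eq[of "sets borel" UNIV "A2_fun \<nu>" "Upsilon_fun A2_dilation \<nu>", OF _ eq]
    by (simp add: sigma_sets_borel)
  show "A2 \<nu> = Upsilon A2_dilation \<nu>"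
    unfolding A2_def Upsilon_def by (rule measure_of_eq[OF _ eq]) auto
qed

section \<open>Mass away from the origin and at the origin\<close>

text \<open>Chebyshev's inequality for the function \<open>min 1 (norm x)\<^sup>2\<close>.\<close>

lemma levy_measure_finite_away:
  fixes \<nu> :: "'a::euclidean_space measure"
  assumes "\<nu> \<in> levy_measures" and e: "e > 0"
  shows "emeasure \<nu> {x. e \<le> norm x} < \<infinity>"
proof -
  have \<nu> [measurable_cong]: "sets \<nu> = sets borel"
    and fin: "(\<integral>\<^sup>+x. ennreal (min 1 ((norm x)\<^sup>2)) \<partial>\<nu>) < \<infinity>"
    using assms by (auto simp: levy_measures_def)
  define c where "c = min 1 (e\<^sup>2)"
  have c: "c > 0" using e by (simp add: c_def)
  have S: "{x. e \<le> norm x} \<in> sets \<nu>" unfolding \<nu>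
    by (intro borel_closed closed_Collect_le continuous_intros)
  have "ennreal c * emeasure \<nu> {x. e \<le> norm x} = (\<integral>\<^sup>+x. ennreal c * indicator {x. e \<le> norm x} x \<partial>\<nu>)"
    using S by (simp add: nn_integral_cmult_indicator)
  also have "\<dots> \<le> (\<integral>\<^sup>+x. ennreal (min 1 ((norm x)\<^sup>2)) \<partial>\<nu>)"
  proof (rule nn_integral_mono)
    fix x :: 'a
    have "c \<le> min 1 ((norm x)\<^sup>2)" if "e \<le> norm x"
      using power_mono[OF that, of 2] e by (simp add: c_def min.coboundedI2)
    then show "ennreal c * indicator {x. e \<le> norm x} x \<le> ennreal (min 1 ((norm x)\<^sup>2))"
      by (auto simp: indicator_def intro!: ennreal_leI)
  qed
  also note fin
  finally show ?thesis using c by (auto simp: ennreal_mult_less_top)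
qed

lemma sigma_finite_if_finite_away:
  fixes \<nu> :: "'a::euclidean_space measure"
  assumes \<nu>: "sets \<nu> = sets borel" and zero: "emeasure \<nu> {0} = 0"
    and fin: "\<And>e. e > 0 \<Longrightarrow> emeasure \<nu> {x. e \<le> norm x} < \<infinity>"
  shows "sigma_finite_measure \<nu>"
proof
  let ?A = "insert {0} (range (\<lambda>n::nat. {x::'a. 1 / real (Suc n) \<le> norm x}))"
  have "{x::'a. e \<le> norm x} \<in> sets borel" for e
    by (intro borel_closed closed_Collect_le continuous_intros)
  then have "?A \<subseteq> sets \<nu>" by (auto simp: \<nu>)
  moreover have "\<Union> ?A = UNIV"
  proof -
    have "x \<in> \<Union> ?A" for x :: 'a
    proof (cases "x = 0")
      case False
      then obtain n where "inverse (real (Suc n)) < norm x"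
        using reals_Archimedean[of "norm x"] by auto
      then have "x \<in> {x. 1 / real (Suc n) \<le> norm x}" by (simp add: field_simps)
      then show ?thesis by blast
    qed simp
    then show ?thesis by blast
  qed
  moreover have "\<forall>a\<in>?A. emeasure \<nu> a \<noteq> \<infinity>"
    using zero fin by (auto simp: less_top[symmetric])
  moreover have "countable ?A" by simp
  moreover have "space \<nu> = UNIV" using sets_eq_imp_space_eq[OF \<nu>] by simp
  ultimately show "\<exists>A. countable A \<and> A \<subseteq> sets \<nu> \<and> \<Union> A = space \<nu> \<and> (\<forall>a\<in>A. emeasure \<nu> a \<noteq> \<infinity>)"
    by metis
qed

text \<open>For \<open>norm x \<ge> 2 e\<close>, every \<open>u\<close> in the upper half of the unit interval moves \<open>x\<close> to
  distance at least \<open>e\<close>. The density is at least \<open>2 / \<pi>\<close>, so this happens with mass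
  at least \<open>1 / \<pi>\<close>.\<close>

lemma emeasure_away_le_A2_fun:
  fixes \<nu> :: "'a::euclidean_space measure"
  assumes \<nu>: "sets \<nu> = sets borel" and e: "e > 0"
  shows "ennreal (1 / pi) * emeasure \<nu> {x. 2 * e \<le> norm x} \<le> A2_fun \<nu> {x. e \<le> norm x}"
proof -
  have S: "{x::'a. r \<le> norm x} \<in> sets borel" for r
    by (intro borel_closed closed_Collect_le continuous_intros)
  have lower: "ennreal (1 / pi) \<le>
      (\<integral>\<^sup>+u. arcsine_density u * indicator {x. e \<le> norm x} (u *\<^sub>R x) \<partial>lborel)"
    if x: "2 * e \<le> norm x" for x :: 'a
  proof -
    have "ennreal (1 / pi) = ennreal (2 / pi) * ennreal (1 / 2)"
      by (subst ennreal_mult''[symmetric]) auto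
    also have "\<dots> = (\<integral>\<^sup>+u. ennreal (2 / pi) * indicator {1/2<..<1::real} u \<partial>lborel)"
      by (subst nn_integral_cmult_indicator) auto
    also have "\<dots> \<le> (\<integral>\<^sup>+u. arcsine_density u * indicator {x. e \<le> norm x} (u *\<^sub>R x) \<partial>lborel)"
    proof (rule nn_integral_mono)
      fix u :: real
      have "e \<le> norm (u *\<^sub>R x)" if "u \<in> {1/2<..<1}"
        using mult_mono[of "1/2" u "2 * e" "norm x"] that x e by auto
      then show "ennreal (2 / pi) * indicator {1/2<..<1} u
          \<le> arcsine_density u * indicator {x. e \<le> norm x} (u *\<^sub>R x)"
        using arcsine_density_ge[of u] by (auto simp: indicator_def)
    qed
    finally show ?thesis .
  qed
  have "ennreal (1 / pi) * emeasure \<nu> {x. 2 * e \<le> norm x} =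
      (\<integral>\<^sup>+x. ennreal (1 / pi) * indicator {x. 2 * e \<le> norm x} x \<partial>\<nu>)"
    using S by (simp add: nn_integral_cmult_indicator \<nu>)
  also have "\<dots> \<le> A2_fun \<nu> {x. e \<le> norm x}"
    unfolding A2_fun_eq_nn_integral[OF S]
    by (intro nn_integral_mono) (use e lower in \<open>auto simp: indicator_def\<close>)
  finally show ?thesis .
qed

lemma A2_domain_sigma_finite:
  fixes \<nu> :: "'a::euclidean_space measure"
  assumes "\<nu> \<in> A2_domain"
  shows "sigma_finite_measure \<nu>"
proof (rule sigma_finite_if_finite_away)
  have ms: "measure_space UNIV (sets borel) (A2_fun \<nu>)" and levy: "A2 \<nu> \<in> levy_measures"
    and \<nu>: "sets \<nu> = sets borel" and zero: "emeasure \<nu> {0} = 0"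
    using assms by (auto simp: A2_domain_def)
  show "sets \<nu> = sets borel" "emeasure \<nu> {0} = 0" by fact+
  fix e :: real assume e: "e > 0"
  have S: "{x::'a. e / 2 \<le> norm x} \<in> sets borel"
    by (intro borel_closed closed_Collect_le continuous_intros)
  have "ennreal (1 / pi) * emeasure \<nu> {x. e \<le> norm x} \<le> emeasure (A2 \<nu>) {x. e / 2 \<le> norm x}"
    unfolding A2_def emeasure_measure_of_borel[OF ms S]
    using emeasure_away_le_A2_fun[OF \<nu>, of "e / 2"] e by simp
  also have "\<dots> < \<infinity>" using levy_measure_finite_away[OF levy, of "e / 2"] e by simp
  finally show "emeasure \<nu> {x. e \<le> norm x} < \<infinity>" by (auto simp: ennreal_mult_less_top)
qed

lemma levy_measure_sigma_finite:
  fixes \<nu> :: "'a::euclidean_space measure"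
  assumes "\<nu> \<in> levy_measures"
  shows "sigma_finite_measure \<nu>"
  using sigma_finite_if_finite_away[of \<nu>] levy_measure_finite_away[OF assms] assms
  by (auto simp: levy_measures_def)

text \<open>All dilates of \<open>{0}\<close> coincide, so the Upsilon transform multiplies the mass at the origin
  by the total mass of the dilation measure; a positive lower bound \<open>2 / \<pi>\<close> for it suffices.\<close>

lemma Upsilon_domain_emeasure_zero:
  fixes \<nu> :: "'a::euclidean_space measure"
  assumes "\<nu> \<in> Upsilon_domain A2_dilation"
  shows "emeasure \<nu> {0} = 0"
proof -
  have ms: "measure_space UNIV (sets borel) (Upsilon_fun A2_dilation \<nu>)"
    and levy: "Upsilon A2_dilation \<nu> \<in> levy_measures"
    and \<nu>: "sets \<nu> = sets borel" and fin: "sigma_finite_measure \<nu>"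
    using assms by (auto simp: Upsilon_domain_def)
  have "ennreal (2 / pi) * emeasure \<nu> {0} =
      (\<integral>\<^sup>+u. ennreal (2 / pi) * emeasure \<nu> {0} * indicator {0<..<1::real} u \<partial>lborel)"
    by (subst nn_integral_cmult_indicator) auto
  also have "\<dots> \<le> (\<integral>\<^sup>+u\<in>{0<..<1}. emeasure \<nu> ((*\<^sub>R) (inverse u) ` {0})
      * ennreal (2 / pi * (1 - u\<^sup>2) powr (- 1 / 2)) \<partial>lborel)"
  proof (rule nn_integral_mono)
    fix u :: real
    have "ennreal (2 / pi) \<le> ennreal (2 / pi * (1 - u\<^sup>2) powr (- 1 / 2))" if "0 < u" "u < 1"
      using arcsine_density_ge[OF that] that by (simp add: arcsine_density_def)
    then show "ennreal (2 / pi) * emeasure \<nu> {0} * indicator {0<..<1} u \<le>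
        emeasure \<nu> ((*\<^sub>R) (inverse u) ` {0})
          * ennreal (2 / pi * (1 - u\<^sup>2) powr (- 1 / 2)) * indicator {0<..<1} u"
      by (cases "u \<in> {0<..<1}")
        (simp_all only: image_insert image_empty scaleR_zero_right mult.commute[of "emeasure \<nu> {0}"],
          auto intro!: mult_right_mono)
  qed
  also have "\<dots> = emeasure (Upsilon A2_dilation \<nu>) {0}"
    by (simp add: Upsilon_def emeasure_measure_of_borel[OF ms]
        Upsilon_fun_A2_dilation(1)[OF \<nu> fin])
  also have "\<dots> = 0" using levy by (simp add: levy_measures_def)
  finally show ?thesis by simp
qed

section \<open>Identification of the two transformations\<close>

theorem theorem3p7:
  shows "(A2_domain :: 'a::euclidean_space measure set) = Upsilon_domain A2_dilation \<and>
    (\<forall>\<nu> \<in> (A2_domain :: 'a measure set). A2 \<nu> = Upsilon A2_dilation \<nu>) \<and>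
    (\<forall>\<nu> \<in> (levy_measures :: 'a measure set). \<forall>B \<in> sets borel.
       emeasure (A2 \<nu>) B =
         (\<integral>\<^sup>+u\<in>{0<..<1}. emeasure \<nu> ((*\<^sub>R) (inverse u) ` B)
            * ennreal (2 / pi * (1 - u\<^sup>2) powr (- 1 / 2)) \<partial>lborel))"
proof (intro conjI ballI)
  show "(A2_domain :: 'a measure set) = Upsilon_domain A2_dilation"
  proof (intro set_eqI)
    fix \<nu> :: "'a measure"
    show "\<nu> \<in> A2_domain \<longleftrightarrow> \<nu> \<in> Upsilon_domain A2_dilation"
    proof (cases "sets \<nu> = sets borel \<and> sigma_finite_measure \<nu> \<and> emeasure \<nu> {0} = 0")
      case True
      then show ?thesis
        using measure_space_A2_iff_Upsilon[of \<nu>] A2_eq_Upsilon[of \<nu>]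
        by (simp add: A2_domain_def Upsilon_domain_def)
    next
      case False
      then show ?thesis
        using A2_domain_sigma_finite[of \<nu>] Upsilon_domain_emeasure_zero[of \<nu>]
        by (auto simp: A2_domain_def Upsilon_domain_def)
    qed
  qed
next
  fix \<nu> :: "'a measure" assume "\<nu> \<in> A2_domain"
  then show "A2 \<nu> = Upsilon A2_dilation \<nu>"
    using A2_domain_sigma_finite[of \<nu>] by (intro A2_eq_Upsilon) (auto simp: A2_domain_def)
next
  fix \<nu> :: "'a measure" and B :: "'a set"
  assume levy: "\<nu> \<in> levy_measures" and B: "B \<in> sets borel"
  have \<nu>: "sets \<nu> = sets borel" and zero: "emeasure \<nu> {0} = 0"
    using levy by (auto simp: levy_measures_def)
  note fin = levy_measure_sigma_finite[OF levy]
  have "emeasure (A2 \<nu>) B = A2_fun \<nu> B"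
    unfolding A2_def by (rule emeasure_measure_of_borel[OF measure_space_A2_fun[OF \<nu>] B])
  also have "\<dots> = Upsilon_fun A2_dilation \<nu> B"
    by (rule A2_fun_eq_Upsilon_fun[OF \<nu> fin zero B])
  finally show "emeasure (A2 \<nu>) B =
      (\<integral>\<^sup>+u\<in>{0<..<1}. emeasure \<nu> ((*\<^sub>R) (inverse u) ` B)
        * ennreal (2 / pi * (1 - u\<^sup>2) powr (- 1 / 2)) \<partial>lborel)"
    by (simp add: Upsilon_fun_A2_dilation(1)[OF \<nu> fin B])
qed

end
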